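(* Let $\mathcal{H}_C$ be a finite-dimensional Hilbert space, $Q_C=D_{\mathrm{Ef}(\mathcal{H}_C)}$, and let $(X,c)$, $(Y,d)$ be $Q_C$-coalgebras with $x\in X$, $y\in Y$. Then $x\sim_k y$ in $(X,c)$ and $(Y,d)$ if and only if $x\sim_k y$ in the $D_{f_C}$-coalgebras $(X,\alpha_{lpp,X}\circ c)$ and $(Y,\alpha_{lpp,Y}\circ d)$.
   Context: $\mathrm{Ef}(\mathcal{H})=\{L:0\sqsubseteq L\sqsubseteq\mathbb{I}\}$ (Löwner order) is an effect algebra with matrix sum (defined iff the sum is $\sqsubseteq\mathbb{I}$), zero matrix and $L'=\mathbb{I}-L$. $\mathrm{DM}(\mathcal{H})$ is the set of density operators (positive semidefinite, trace one). $f_C=\mathbf{Conv}(\mathrm{DM}(\mathcal{H}_C),[0,1])$ is the set of convex functions $g:\mathrm{DM}(\mathcal{H}_C)\to[0,1]$ (i.e. $g(p\rho+(1-p)\sigma)=pg(\rho)+(1-p)g(\sigma)$), an effect algebra under pointwise sum (defined when pointwise $\le1$), zero function and $g'=1-g$; the map $L\mapsto\lambda\rho.\,\mathrm{tr}(L\rho)$ is an effect algebra isomorphism $\mathrm{Ef}(\mathcal{H}_C)\to f_C$. For an effect algebra $\mathbb{E}$, $D_{\mathbb{E}}X$ is the set of finitely supported $\Delta:X\to\mathbb{E}$ whose sum over the support is defined, with $(D_{\mathbb{E}}f)(\Delta)(y)=\sum_{x\in f^{-1}(y)}\Delta(x)$. $\alpha_{lpp,X}:Q_CX\to D_{f_C}X$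 sends $\Delta$ to $x\mapsto\lambda\rho.\,\mathrm{tr}(\Delta(x)\rho)$. A coalgebra $(X,c)$ has $c:X\to D_{\mathbb{E}}X$; a homomorphism $f:(X,c)\to(Y,d)$ satisfies $D_{\mathbb{E}}f\circ c=d\circ f$. Kernel bisimilarity: $x\sim_k y$ iff there is a cospan of maps $X\xrightarrow{m_1}Z\xleftarrow{m_2}Y$ and a coalgebra $(Z,e)$ making $m_1,m_2$ homomorphisms, with $m_1(x)=m_2(y)$. *)

theory Defs
  imports
    "Jordan_Normal_Form.Schur_Decomposition"
    "HOL-Library.FuncSet"
begin

section \<open>Effect algebras\<close>

record 'a eff_alg = "'a partial_object" +
  ezero :: 'a
  eplus :: "'a \<Rightarrow> 'a \<Rightarrow> 'a option"
  ortho :: "'a \<Rightarrow> 'a"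

text \<open>The partial sum is option-valued, with \<open>None\<close> for an undefined sum.  Sums involving an
  element outside the carrier are undefined, so commutativity and associativity hold for all
  elements of the type.  Associativity is Kleene equality.\<close>

locale effect_algebra =
  fixes E :: "('a, 'm) eff_alg_scheme"
  assumes zero_closed: "ezero E \<in> carrier E"
    and ortho_closed: "a \<in> carrier E \<Longrightarrow> ortho E a \<in> carrier E"
    and plus_closed: "eplus E a b = Some c \<Longrightarrow> a \<in> carrier E \<and> b \<in> carrier E \<and> c \<in> carrier E"
    and plus_comm: "eplus E a b = eplus E b a"
    and plus_assoc:
      "Option.bind (eplus E a b) (\<lambda>s. eplus E s c) = Option.bind (eplus E b c) (\<lambda>s. eplus E a s)"
    and plus_zero: "a \<in> carrier E \<Longrightarrow> eplus E (ezero E) a = Some a"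
    and plus_ortho: "a \<in> carrier E \<Longrightarrow> eplus E a (ortho E a) = Some (ortho E (ezero E))"
    and ortho_unique: "eplus E a b = Some (ortho E (ezero E)) \<Longrightarrow> b = ortho E a"
    and zero_one: "eplus E a (ortho E (ezero E)) = Some c \<Longrightarrow> a = ezero E"

text \<open>Sum of a finite family, \<open>None\<close> if it is not defined.  Independence of the order of summation
  is lemma \<open>esum_insert\<close> below.\<close>

definition esum :: "('a, 'm) eff_alg_scheme \<Rightarrow> ('i \<Rightarrow> 'a) \<Rightarrow> 'i set \<Rightarrow> 'a option" where
  "esum E h I = Finite_Set.fold (\<lambda>i s. Option.bind s (\<lambda>a. eplus E (h i) a)) (Some (ezero E)) I"

lemma (in effect_algebra) esum_empty: "esum E h {} = Some (ezero E)"
  by (simp add: esum_def)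

lemma (in effect_algebra) esum_insert:
  assumes "finite I" "i \<notin> I"
  shows "esum E h (insert i I) = Option.bind (esum E h I) (\<lambda>a. eplus E (h i) a)"
proof -
  have swap: "Option.bind (eplus E (h x) a) (eplus E (h y)) =
      Option.bind (eplus E (h y) a) (eplus E (h x))" for x y a
  proof -
    have "(\<lambda>s. eplus E s (h y)) = eplus E (h y)" by (rule ext) (rule plus_comm)
    with plus_assoc[of "h x" a "h y"] show ?thesis by (simp add: plus_comm[of a "h y"])
  qed
  interpret comp_fun_commute "\<lambda>i s. Option.bind s (\<lambda>a. eplus E (h i) a)"
  proof
    fix x y
    show "(\<lambda>s. Option.bind s (eplus E (h y))) \<circ> (\<lambda>s. Option.bind s (eplus E (h x))) =
          (\<lambda>s. Option.bind s (eplus E (h x))) \<circ> (\<lambda>s. Option.bind s (eplus E (h y)))"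
    proof
      fix s
      show "((\<lambda>s. Option.bind s (eplus E (h y))) \<circ> (\<lambda>s. Option.bind s (eplus E (h x)))) s =
            ((\<lambda>s. Option.bind s (eplus E (h x))) \<circ> (\<lambda>s. Option.bind s (eplus E (h y)))) s"
        by (cases s) (use swap in auto)
    qed
  qed
  show ?thesis unfolding esum_def using assms by (rule fold_insert)
qed


section \<open>Coalgebras for the functor \<open>D\<^sub>E\<close>\<close>

definition esupp :: "('a, 'm) eff_alg_scheme \<Rightarrow> 'x set \<Rightarrow> ('x \<Rightarrow> 'a) \<Rightarrow> 'x set" where
  "esupp E X \<Delta> = {x \<in> X. \<Delta> x \<noteq> ezero E}"

text \<open>Maps \<open>X \<rightarrow> E\<close> on a carrier set \<open>X\<close> are represented by functions that vanish outside \<open>X\<close>, so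
  that HOL equality is equality of maps on \<open>X\<close>.\<close>

definition Dist :: "('a, 'm) eff_alg_scheme \<Rightarrow> 'x set \<Rightarrow> ('x \<Rightarrow> 'a) set" where
  "Dist E X = {\<Delta>. (\<forall>x\<in>X. \<Delta> x \<in> carrier E) \<and> (\<forall>x. x \<notin> X \<longrightarrow> \<Delta> x = ezero E) \<and>
     finite (esupp E X \<Delta>) \<and> esum E \<Delta> (esupp E X \<Delta>) \<noteq> None}"

text \<open>The sum over \<open>f\<^sup>-\<^sup>1(y)\<close> is taken over the finitely many points of it where \<open>\<Delta>\<close> is nonzero.\<close>

definition Dmap :: "('a, 'm) eff_alg_scheme \<Rightarrow> 'x set \<Rightarrow> ('x \<Rightarrow> 'y) \<Rightarrow> ('x \<Rightarrow> 'a) \<Rightarrow> 'y \<Rightarrow> 'a" where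
  "Dmap E X f \<Delta> = (\<lambda>y. the (esum E \<Delta> {x \<in> esupp E X \<Delta>. f x = y}))"

definition coalgebra :: "('a, 'm) eff_alg_scheme \<Rightarrow> 'x set \<Rightarrow> ('x \<Rightarrow> 'x \<Rightarrow> 'a) \<Rightarrow> bool" where
  "coalgebra E X c \<longleftrightarrow> c \<in> X \<rightarrow> Dist E X"

definition coalg_hom ::
  "('a, 'm) eff_alg_scheme \<Rightarrow> 'x set \<Rightarrow> ('x \<Rightarrow> 'x \<Rightarrow> 'a) \<Rightarrow> 'y set \<Rightarrow> ('y \<Rightarrow> 'y \<Rightarrow> 'a) \<Rightarrow>
   ('x \<Rightarrow> 'y) \<Rightarrow> bool" where
  "coalg_hom E X c Y d f \<longleftrightarrow> f \<in> X \<rightarrow> Y \<and> (\<forall>x\<in>X. Dmap E X f (c x) = d (f x))"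

text \<open>HOL cannot quantify existentially over types, so the apex of the cospan is a subset of
  \<open>'x + 'y\<close>.  Lemma \<open>kernel_bisimilarI\<close> shows that this is no restriction: any cospan, over any
  type, yields one of this form.\<close>

definition kernel_bisimilar ::
  "('a, 'm) eff_alg_scheme \<Rightarrow> 'x set \<Rightarrow> ('x \<Rightarrow> 'x \<Rightarrow> 'a) \<Rightarrow> 'y set \<Rightarrow> ('y \<Rightarrow> 'y \<Rightarrow> 'a) \<Rightarrow>
   'x \<Rightarrow> 'y \<Rightarrow> bool" where
  "kernel_bisimilar E X c Y d x y \<longleftrightarrow>
     (\<exists>(Z :: ('x + 'y) set) e m1 m2. coalgebra E Z e \<and>
        coalg_hom E X c Z e m1 \<and> coalg_hom E Y d Z e m2 \<and> m1 x = m2 y)"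

lemma esum_image:
  assumes "inj_on g I"
  shows "esum E h (g ` I) = esum E (h \<circ> g) I"
  unfolding esum_def by (subst fold_image[OF assms]) (simp add: comp_def)

lemma esum_cong:
  assumes "\<And>i. i \<in> I \<Longrightarrow> h i = h' i"
  shows "esum E h I = esum E h' I"
  unfolding esum_def by (rule Finite_Set.fold_closed_eq[where B = UNIV]) (auto simp: assms)

lemma Dmap_outside: "y \<notin> f ` X \<Longrightarrow> Dmap E X f \<Delta> y = ezero E"
proof -
  assume "y \<notin> f ` X"
  then have "{x \<in> esupp E X \<Delta>. f x = y} = {}" by (auto simp: esupp_def)
  then show ?thesis unfolding Dmap_def esum_def by (simp only: fold_empty option.sel)
qed

lemma coalg_hom_transport:
  assumes m: "coalg_hom E X c Z e m" and W: "m ` X \<subseteq> W" and inj: "inj_on h W"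
  shows "coalg_hom E X c (h ` W)
    (\<lambda>u v. if v \<in> h ` W then e (inv_into W h u) (inv_into W h v) else ezero E) (h \<circ> m)"
    (is "coalg_hom E X c ?Z ?e _")
  unfolding coalg_hom_def
proof (intro conjI ballI)
  show "h \<circ> m \<in> X \<rightarrow> ?Z" using W by auto
  fix a assume a: "a \<in> X"
  then have eq: "e (m a) = Dmap E X m (c a)" and aW: "m a \<in> W"
    using m W by (auto simp: coalg_hom_def)
  show "Dmap E X (h \<circ> m) (c a) = ?e ((h \<circ> m) a)"
  proof
    fix v
    show "Dmap E X (h \<circ> m) (c a) v = ?e ((h \<circ> m) a) v"
    proof (cases "v \<in> ?Z")
      case True
      have "(h \<circ> m) b = v \<longleftrightarrow> m b = inv_into W h v" if "b \<in> X" for b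
        using that W True inj_on_eq_iff[OF inj] by (fastforce simp: inv_into_f_f[OF inj])
      then have "{b \<in> esupp E X (c a). (h \<circ> m) b = v} =
          {b \<in> esupp E X (c a). m b = inv_into W h v}"
        by (auto simp: esupp_def)
      then show ?thesis using True eq aW inj by (simp add: Dmap_def)
    next
      case False
      then have "v \<notin> (h \<circ> m) ` X" using W by auto
      then show ?thesis using False by (simp add: Dmap_outside)
    qed
  qed
qed

lemma kernel_bisimilarI:
  fixes Z :: "'z set" and X :: "'x set" and Y :: "'y set"
  assumes e: "coalgebra E Z e"
    and m1: "coalg_hom E X c Z e m1" and m2: "coalg_hom E Y d Z e m2"
    and xy: "x \<in> X" "y \<in> Y" "m1 x = m2 y"
  shows "kernel_bisimilar E X c Y d x y"
proof -
  define W where "W = m1 ` X \<union> m2 ` Y"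
  define h :: "'z \<Rightarrow> 'x + 'y" where
    "h w = (if w \<in> m1 ` X then Inl (inv_into X m1 w) else Inr (inv_into Y m2 w))" for w
  have inj: "inj_on h W"
  proof (rule inj_onI)
    fix u v assume "u \<in> W" "v \<in> W" "h u = h v"
    then show "u = v" unfolding h_def W_def
      by (auto split: if_splits dest: inv_into_injective)
  qed
  define k where "k = inv_into W h"
  have kh: "k (h w) = w" if "w \<in> W" for w using that inj by (simp add: k_def)
  define Z' where "Z' = h ` W"
  have kW: "k u \<in> W" "h (k u) = u" if "u \<in> Z'" for u
    using that kh by (auto simp: Z'_def)
  define e' where "e' u = (\<lambda>v. if v \<in> Z' then e (k u) (k v) else ezero E)" for u
  have WZ: "W \<subseteq> Z" using m1 m2 by (auto simp: W_def coalg_hom_def)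
  have zeroW: "e w v = ezero E" if w: "w \<in> W" and v: "v \<notin> W" for w v
  proof -
    from w consider a where "a \<in> X" "w = m1 a" | a where "a \<in> Y" "w = m2 a"
      by (auto simp: W_def)
    then show ?thesis
    proof cases
      case 1
      then have "e w = Dmap E X m1 (c a)" using m1 by (simp add: coalg_hom_def)
      then show ?thesis using v by (simp add: Dmap_outside W_def)
    next
      case 2
      then have "e w = Dmap E Y m2 (d a)" using m2 by (simp add: coalg_hom_def)
      then show ?thesis using v by (simp add: Dmap_outside W_def)
    qed
  qed
  have coalg': "coalgebra E Z' e'"
    unfolding coalgebra_def
  proof
    fix u assume u: "u \<in> Z'"
    have D: "e (k u) \<in> Dist E Z" using e kW(1)[OF u] WZ by (auto simp: coalgebra_def)
    have suppW: "esupp E Z (e (k u)) \<subseteq> W"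
      using zeroW[OF kW(1)[OF u]] by (auto simp: esupp_def)
    have supp: "esupp E Z' (e' u) = h ` esupp E Z (e (k u))"
    proof (intro subset_antisym subsetI)
      fix v assume "v \<in> esupp E Z' (e' u)"
      then have "v \<in> Z'" "e (k u) (k v) \<noteq> ezero E" by (auto simp: esupp_def e'_def)
      then have "k v \<in> esupp E Z (e (k u))" "v = h (k v)"
        using kW[of v] WZ by (auto simp: esupp_def)
      then show "v \<in> h ` esupp E Z (e (k u))" by blast
    next
      fix v assume "v \<in> h ` esupp E Z (e (k u))"
      then obtain w where w: "w \<in> esupp E Z (e (k u))" "v = h w" by blast
      then have "w \<in> W" using suppW by blast
      then show "v \<in> esupp E Z' (e' u)"
        using w by (auto simp: esupp_def e'_def Z'_def kh)
    qed
    have "esum E (e' u) (esupp E Z' (e' u)) = esum E (e' u \<circ> h) (esupp E Z (e (k u)))"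
      unfolding supp by (rule esum_image) (rule inj_on_subset[OF inj suppW])
    also have "\<dots> = esum E (e (k u)) (esupp E Z (e (k u)))"
      by (rule esum_cong) (use suppW kh in \<open>fastforce simp: e'_def Z'_def\<close>)
    finally have sum: "esum E (e' u) (esupp E Z' (e' u)) = esum E (e (k u)) (esupp E Z (e (k u)))" .
    have "e (k u) (k v) \<in> carrier E" if "v \<in> Z'" for v
      using D kW(1)[OF that] WZ by (auto simp: Dist_def)
    then show "e' u \<in> Dist E Z'"
      using D sum supp by (auto simp: Dist_def e'_def)
  qed
  have hom1: "coalg_hom E X c Z' e' (h \<circ> m1)" and hom2: "coalg_hom E Y d Z' e' (h \<circ> m2)"
    unfolding Z'_def e'_def k_def
    by (rule coalg_hom_transport[OF m1 _ inj] coalg_hom_transport[OF m2 _ inj], simp add: W_def)+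
  have "(h \<circ> m1) x = (h \<circ> m2) y" using xy(3) by simp
  then show ?thesis unfolding kernel_bisimilar_def using coalg' hom1 hom2 by blast
qed


section \<open>Effects, density operators and convex functions\<close>

text \<open>The Hilbert space of dimension \<open>n\<close> is \<open>\<complex>\<^sup>n\<close>, with operators as \<open>n \<times> n\<close> matrices.\<close>

definition mtrace :: "complex mat \<Rightarrow> complex" where
  "mtrace A = (\<Sum>i<dim_row A. A $$ (i, i))"

text \<open>\<open>0 \<le> z\<close> for complex \<open>z\<close> means that \<open>z\<close> is real and nonnegative.\<close>

definition psd :: "nat \<Rightarrow> complex mat \<Rightarrow> bool" where
  "psd n A \<longleftrightarrow> A \<in> carrier_mat n n \<and> mat_adjoint A = A \<and>
     (\<forall>v \<in> carrier_vec n. 0 \<le> (A *\<^sub>v v) \<bullet>c v)"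

definition loewner_le :: "nat \<Rightarrow> complex mat \<Rightarrow> complex mat \<Rightarrow> bool" where
  "loewner_le n A B \<longleftrightarrow> A \<in> carrier_mat n n \<and> B \<in> carrier_mat n n \<and> psd n (B - A)"

definition Ef_set :: "nat \<Rightarrow> complex mat set" where
  "Ef_set n = {L. loewner_le n (0\<^sub>m n n) L \<and> loewner_le n L (1\<^sub>m n)}"

definition Ef :: "nat \<Rightarrow> complex mat eff_alg" where
  "Ef n = \<lparr> carrier = Ef_set n, ezero = 0\<^sub>m n n,
     eplus = (\<lambda>A B. if A \<in> Ef_set n \<and> B \<in> Ef_set n \<and> loewner_le n (A + B) (1\<^sub>m n)
                    then Some (A + B) else None),
     ortho = (\<lambda>A. 1\<^sub>m n - A) \<rparr>"

lemma kleene_assoc: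
  assumes pc: "\<And>a b. P a b = P b a"
    and dir: "\<And>a b c t. Option.bind (P a b) (\<lambda>s. P s c) = Some t \<Longrightarrow>
      Option.bind (P b c) (\<lambda>s. P a s) = Some t"
  shows "Option.bind (P a b) (\<lambda>s. P s c) = Option.bind (P b c) (\<lambda>s. P a s)"
proof -
  have "P b a = P a b" "P c b = P b c" "(\<lambda>s. P s a) = P a" "(\<lambda>s. P s c) = P c"
    using pc by auto
  then show ?thesis using dir[of a b c] dir[of c b a] by (metis not_Some_eq)
qed

lemma adjoint_index:
  assumes "A \<in> carrier_mat n n" "i < n" "j < n"
  shows "mat_adjoint A $$ (i, j) = cnj (A $$ (j, i))"
  using assms by (simp add: mat_adjoint_def mat_of_rows_def)

lemma psd_carrier: "psd n A \<Longrightarrow> A \<in> carrier_mat n n"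
  by (simp add: psd_def)

lemma psd_add:
  assumes "psd n A" "psd n B"
  shows "psd n (A + B)"
proof -
  have A: "A \<in> carrier_mat n n" and B: "B \<in> carrier_mat n n"
    using assms by (auto simp: psd_def)
  have hA: "mat_adjoint A $$ (i, j) = A $$ (i, j)" "mat_adjoint B $$ (i, j) = B $$ (i, j)" for i j
    using assms by (simp_all add: psd_def)
  have "mat_adjoint (A + B) = A + B"
  proof (rule eq_matI)
    show "dim_row (mat_adjoint (A + B)) = dim_row (A + B)"
      "dim_col (mat_adjoint (A + B)) = dim_col (A + B)"
      using A B by (auto simp: mat_adjoint_def)
    fix i j assume "i < dim_row (A + B)" "j < dim_col (A + B)"
    then have ij: "i < n" "j < n" using A B by auto
    then have "mat_adjoint (A + B) $$ (i, j) = mat_adjoint A $$ (i, j) + mat_adjoint B $$ (i, j)"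
      using A B by (simp add: adjoint_index[of _ n])
    then show "mat_adjoint (A + B) $$ (i, j) = (A + B) $$ (i, j)"
      using ij A B hA by simp
  qed
  moreover have "0 \<le> ((A + B) *\<^sub>v v) \<bullet>c v" if v: "v \<in> carrier_vec n" for v
  proof -
    have "((A + B) *\<^sub>v v) \<bullet>c v = (A *\<^sub>v v) \<bullet>c v + (B *\<^sub>v v) \<bullet>c v"
      using A B v by (simp add: add_mult_distrib_mat_vec[of _ n n] add_scalar_prod_distrib[of _ n])
    then show ?thesis using assms v by (auto simp: psd_def)
  qed
  ultimately show ?thesis using A B by (auto simp: psd_def)
qed

lemma psd_zero: "psd n (0\<^sub>m n n)"
proof -
  have "mat_adjoint (0\<^sub>m n n :: complex mat) = 0\<^sub>m n n"
    by (rule eq_matI) (auto simp: adjoint_index[of _ n] mat_adjoint_def mat_of_rows_def)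
  moreover have "0 \<le> (0\<^sub>m n n *\<^sub>v v) \<bullet>c v" if "v \<in> carrier_vec n" for v :: "complex vec"
  proof -
    have "0\<^sub>m n n *\<^sub>v v = 0\<^sub>v n" using that by (intro eq_vecI) auto
    then show ?thesis using that by (simp add: scalar_prod_left_zero[of _ n])
  qed
  ultimately show ?thesis by (simp add: psd_def)
qed

lemma psd_one: "psd n (1\<^sub>m n)"
proof -
  have "mat_adjoint (1\<^sub>m n :: complex mat) = 1\<^sub>m n"
    by (rule eq_matI) (auto simp: adjoint_index[of _ n] mat_adjoint_def mat_of_rows_def)
  then show ?thesis by (auto simp: psd_def)
qed

lemma psd_antisym:
  assumes "psd n A" "psd n (- A)"
  shows "A = 0\<^sub>m n n"
proof -
  have A: "A \<in> carrier_mat n n" using assms by (auto simp: psd_def)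
  have q0: "(A *\<^sub>v v) \<bullet>c v = 0" if v: "v \<in> carrier_vec n" for v
  proof -
    have "(- A *\<^sub>v v) \<bullet>c v = - ((A *\<^sub>v v) \<bullet>c v)" using A v by auto
    moreover have "0 \<le> (A *\<^sub>v v) \<bullet>c v" "0 \<le> (- A *\<^sub>v v) \<bullet>c v"
      using assms v by (simp_all add: psd_def)
    ultimately show ?thesis by (simp add: less_eq_complex_def complex_eq_iff)
  qed
  have "A $$ (i, j) = 0" if ij: "i < n" "j < n" for i j
  proof -
    define q where "q k = unit_vec n i + k \<cdot>\<^sub>v unit_vec n j" for k :: complex
    have sp: "u \<bullet>c q k = u $ i + cnj k * u $ j" if "u \<in> carrier_vec n" for u k
    proof -
      have "conjugate (q k) = unit_vec n i + cnj k \<cdot>\<^sub>v unit_vec n j"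
        by (rule eq_vecI) (auto simp: q_def unit_vec_def)
      then show ?thesis using that ij
        by (simp add: scalar_prod_add_distrib[of _ n])
    qed
    have mu: "A *\<^sub>v unit_vec n l = col A l" if "l < n" for l
      using A that by (intro eq_vecI) auto
    have mv: "A *\<^sub>v q k = col A i + k \<cdot>\<^sub>v col A j" for k
      using A ij by (simp add: q_def mult_add_distrib_mat_vec[of _ n n] mult_mat_vec[of _ n n] mu)
    have "A $$ (i, i) + k * A $$ (i, j) + cnj k * (A $$ (j, i) + k * A $$ (j, j)) = 0" for k
      using q0[of "q k"] sp[of "A *\<^sub>v q k" k] A ij
      by (simp add: mv) (simp add: q_def)
    from this[of 0] this[of 1] this[of "-1"] this[of \<i>] this[of "- \<i>"]
    show ?thesis by (simp add: complex_eq_iff)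
  qed
  then show ?thesis using A by (intro eq_matI) auto
qed

lemma Ef_set_iff: "L \<in> Ef_set n \<longleftrightarrow> psd n L \<and> psd n (1\<^sub>m n - L)"
proof -
  have "L - 0\<^sub>m n n = L" if "L \<in> carrier_mat n n" using that by auto
  then show ?thesis unfolding Ef_set_def loewner_le_def using psd_carrier[of n L] by auto
qed

lemma effect_algebra_Ef: "effect_algebra (Ef n)"
proof
  let ?E = "Ef n"
  have one: "ortho ?E (ezero ?E) = 1\<^sub>m n" by (auto simp: Ef_def)
  have car: "A \<in> carrier_mat n n" if "A \<in> Ef_set n" for A
    using that by (simp add: Ef_set_iff psd_carrier)
  have plus: "eplus ?E A B = Some C \<longleftrightarrow> A \<in> Ef_set n \<and> B \<in> Ef_set n \<and> C \<in> Ef_set n \<and> C = A + B" for A B C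
    using psd_add[of n A B] by (auto simp: Ef_def loewner_le_def Ef_set_iff psd_carrier)
  have comm: "A + B = B + A" if "A \<in> Ef_set n" "B \<in> Ef_set n" for A B
    using that car by (auto intro: comm_add_mat)
  have compl: "1\<^sub>m n - A \<in> Ef_set n" if "A \<in> Ef_set n" for A
  proof -
    have "1\<^sub>m n - (1\<^sub>m n - A) = A" using car[OF that] by (intro eq_matI) auto
    then show ?thesis using that by (simp add: Ef_set_iff)
  qed
  have sub: "A \<in> Ef_set n" if "psd n A" "psd n B" "A + B \<in> Ef_set n" for A B
  proof -
    have "1\<^sub>m n - A = (1\<^sub>m n - (A + B)) + B"
      using psd_carrier[OF that(1)] psd_carrier[OF that(2)] by (intro eq_matI) auto
    then show ?thesis using that psd_add[of n "1\<^sub>m n - (A + B)" B] by (simp add: Ef_set_iff)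
  qed
  show "ezero ?E \<in> carrier ?E"
  proof -
    have "1\<^sub>m n - 0\<^sub>m n n = (1\<^sub>m n :: complex mat)" by (intro eq_matI) auto
    then show ?thesis by (simp add: Ef_def Ef_set_iff psd_zero psd_one)
  qed
  then have z: "0\<^sub>m n n \<in> Ef_set n" by (simp add: Ef_def)
  have o: "1\<^sub>m n \<in> Ef_set n" using compl[OF z] one by (simp add: Ef_def)
  show "ortho ?E a \<in> carrier ?E" if "a \<in> carrier ?E" for a
    using compl that by (simp add: Ef_def)
  show "a \<in> carrier ?E \<and> b \<in> carrier ?E \<and> c \<in> carrier ?E" if "eplus ?E a b = Some c" for a b c
    using that unfolding plus by (auto simp: Ef_def)
  show pc: "eplus ?E a b = eplus ?E b a" for a b
    using comm[of a b] by (auto simp: Ef_def)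
  have dir: "Option.bind (eplus ?E b c) (\<lambda>s. eplus ?E a s) = Some t"
    if "Option.bind (eplus ?E a b) (\<lambda>s. eplus ?E s c) = Some t" for a b c t
  proof -
    from that have m: "a \<in> Ef_set n" "b \<in> Ef_set n" "c \<in> Ef_set n" "t \<in> Ef_set n" "t = a + b + c"
      by (auto simp: bind_eq_Some_conv plus)
    then have t: "t = a + (b + c)" using car by (simp add: assoc_add_mat[of _ n n])
    have bc: "b + c \<in> Ef_set n"
    proof (rule sub)
      show "psd n (b + c)" "psd n a" using m by (auto simp: Ef_set_iff intro: psd_add)
      have "b + c + a = t" using t m car by (simp add: comm_add_mat[of _ n n])
      then show "b + c + a \<in> Ef_set n" using m by simp
    qed
    show ?thesis using m t bc by (auto simp: bind_eq_Some_conv plus)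
  qed
  show "Option.bind (eplus ?E a b) (\<lambda>s. eplus ?E s c) = Option.bind (eplus ?E b c) (\<lambda>s. eplus ?E a s)" for a b c
    using pc dir by (rule kleene_assoc)
  show "eplus ?E (ezero ?E) a = Some a" if "a \<in> carrier ?E" for a
    using that z car by (simp add: plus) (simp add: Ef_def left_add_zero_mat[of _ n n])
  show "eplus ?E a (ortho ?E a) = Some (ortho ?E (ezero ?E))" if "a \<in> carrier ?E" for a
  proof -
    have a: "a \<in> Ef_set n" using that by (simp add: Ef_def)
    have "a + (1\<^sub>m n - a) = 1\<^sub>m n" using car[OF a] by (intro eq_matI) auto
    then show ?thesis unfolding one plus using a compl[OF a] o by (simp add: Ef_def)
  qed
  show "b = ortho ?E a" if "eplus ?E a b = Some (ortho ?E (ezero ?E))" for a b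
  proof -
    from that have m: "a \<in> Ef_set n" "b \<in> Ef_set n" "1\<^sub>m n = a + b" unfolding one plus by auto
    have "b = (a + b) - a" using car[OF m(1)] car[OF m(2)] by (intro eq_matI) auto
    then show ?thesis using m(3) by (simp add: Ef_def)
  qed
  show "a = ezero ?E" if "eplus ?E a (ortho ?E (ezero ?E)) = Some c" for a c
  proof -
    from that have m: "a \<in> Ef_set n" "a + 1\<^sub>m n \<in> Ef_set n" unfolding one plus by auto
    have "1\<^sub>m n - (a + 1\<^sub>m n) = - a" using car[OF m(1)] by (intro eq_matI) auto
    then show ?thesis using m psd_antisym[of n a] by (simp add: Ef_set_iff Ef_def)
  qed
qed

definition DM :: "nat \<Rightarrow> complex mat set" where
  "DM n = {\<rho>. psd n \<rho> \<and> mtrace \<rho> = 1}"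

lemma psd_scale:
  assumes "psd n A" "0 \<le> r"
  shows "psd n (of_real r \<cdot>\<^sub>m A)"
proof -
  have A: "A \<in> carrier_mat n n" and h: "mat_adjoint A $$ (i, j) = A $$ (i, j)" for i j
    using assms by (simp_all add: psd_def)
  have "mat_adjoint (of_real r \<cdot>\<^sub>m A) = of_real r \<cdot>\<^sub>m A"
  proof (rule eq_matI)
    show "dim_row (mat_adjoint (of_real r \<cdot>\<^sub>m A)) = dim_row (of_real r \<cdot>\<^sub>m A)"
      "dim_col (mat_adjoint (of_real r \<cdot>\<^sub>m A)) = dim_col (of_real r \<cdot>\<^sub>m A)"
      using A by (auto simp: mat_adjoint_def)
    fix i j assume "i < dim_row (of_real r \<cdot>\<^sub>m A)" "j < dim_col (of_real r \<cdot>\<^sub>m A)"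
    then have ij: "i < n" "j < n" using A by auto
    then have "mat_adjoint (of_real r \<cdot>\<^sub>m A) $$ (i, j) = of_real r * mat_adjoint A $$ (i, j)"
      using A by (simp add: adjoint_index[of _ n])
    then show "mat_adjoint (of_real r \<cdot>\<^sub>m A) $$ (i, j) = (of_real r \<cdot>\<^sub>m A) $$ (i, j)"
      using ij A h by simp
  qed
  moreover have "0 \<le> (of_real r \<cdot>\<^sub>m A *\<^sub>v v) \<bullet>c v" if v: "v \<in> carrier_vec n" for v
  proof -
    have "of_real r \<cdot>\<^sub>m A *\<^sub>v v = of_real r \<cdot>\<^sub>v (A *\<^sub>v v)"
      using A v by (intro eq_vecI) (auto simp: scalar_prod_def sum_distrib_left mult.assoc)
    then have "(of_real r \<cdot>\<^sub>m A *\<^sub>v v) \<bullet>c v = of_real r * ((A *\<^sub>v v) \<bullet>c v)"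
      using A v by simp
    moreover have "0 \<le> (A *\<^sub>v v) \<bullet>c v" using assms v by (simp add: psd_def)
    ultimately show ?thesis using assms(2) by (simp add: less_eq_complex_def)
  qed
  ultimately show ?thesis using A by (simp add: psd_def)
qed

lemma DM_convex:
  assumes "\<rho> \<in> DM n" "\<sigma> \<in> DM n" "p \<in> {0..1::real}"
  shows "of_real p \<cdot>\<^sub>m \<rho> + of_real (1 - p) \<cdot>\<^sub>m \<sigma> \<in> DM n"
proof -
  have c: "\<rho> \<in> carrier_mat n n" "\<sigma> \<in> carrier_mat n n"
    using assms by (auto simp: DM_def psd_carrier)
  have "mtrace (of_real p \<cdot>\<^sub>m \<rho> + of_real (1 - p) \<cdot>\<^sub>m \<sigma>) = of_real p * mtrace \<rho> + of_real (1 - p) * mtrace \<sigma>"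
    using c by (simp add: mtrace_def sum.distrib sum_distrib_left)
  then show ?thesis
    using assms by (auto simp: DM_def intro!: psd_add psd_scale simp del: of_real_diff)
      (simp flip: of_real_add)
qed

text \<open>``Convex'' means preserving convex combinations (affine), not the inequality of
  \<open>convex_on\<close>.\<close>

definition ConvFn_set :: "nat \<Rightarrow> (complex mat \<Rightarrow> real) set" where
  "ConvFn_set n = {g \<in> DM n \<rightarrow>\<^sub>E {0..1}. \<forall>\<rho>\<in>DM n. \<forall>\<sigma>\<in>DM n. \<forall>p\<in>{0..1::real}.
     g (of_real p \<cdot>\<^sub>m \<rho> + of_real (1 - p) \<cdot>\<^sub>m \<sigma>) = p * g \<rho> + (1 - p) * g \<sigma>}"

definition ConvFn :: "nat \<Rightarrow> (complex mat \<Rightarrow> real) eff_alg" where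
  "ConvFn n = \<lparr> carrier = ConvFn_set n, ezero = (\<lambda>\<rho>\<in>DM n. 0),
     eplus = (\<lambda>f g. if f \<in> ConvFn_set n \<and> g \<in> ConvFn_set n \<and> (\<forall>\<rho>\<in>DM n. f \<rho> + g \<rho> \<le> 1)
                    then Some (\<lambda>\<rho>\<in>DM n. f \<rho> + g \<rho>) else None),
     ortho = (\<lambda>g. \<lambda>\<rho>\<in>DM n. 1 - g \<rho>) \<rparr>"

lemma effect_algebra_ConvFn: "effect_algebra (ConvFn n)"
proof
  let ?E = "ConvFn n"
  have one: "ortho ?E (ezero ?E) = (\<lambda>\<rho>\<in>DM n. 1)" by (auto simp: ConvFn_def)
  have mix: "of_real p \<cdot>\<^sub>m \<rho> + of_real (1 - p) \<cdot>\<^sub>m \<sigma> \<in> DM n"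
    if "\<rho> \<in> DM n" "\<sigma> \<in> DM n" "p \<in> {0..1}" for \<rho> \<sigma> p
    using that by (rule DM_convex)
  have rng: "0 \<le> g \<rho>" "g \<rho> \<le> 1" if "g \<in> ConvFn_set n" "\<rho> \<in> DM n" for g \<rho>
    using that by (auto simp: ConvFn_set_def PiE_def Pi_def)
  have ext: "f = g" if "f \<in> ConvFn_set n" "g \<in> ConvFn_set n" "\<And>\<rho>. \<rho> \<in> DM n \<Longrightarrow> f \<rho> = g \<rho>" for f g
    using that by (intro PiE_ext[of f "DM n" "\<lambda>_. {0..1}" g]) (auto simp: ConvFn_set_def)
  have cv: "g (of_real p \<cdot>\<^sub>m \<rho> + of_real (1 - p) \<cdot>\<^sub>m \<sigma>) = p * g \<rho> + (1 - p) * g \<sigma>"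
    if "g \<in> ConvFn_set n" "\<rho> \<in> DM n" "\<sigma> \<in> DM n" "p \<in> {0..1}" for g \<rho> \<sigma> p
    using that unfolding ConvFn_set_def by blast
  have const: "(\<lambda>\<rho>\<in>DM n. r) \<in> ConvFn_set n" if "r \<in> {0..1}" for r
    unfolding ConvFn_set_def
  proof (intro CollectI conjI ballI)
    show "(\<lambda>\<rho>\<in>DM n. r) \<in> DM n \<rightarrow>\<^sub>E {0..1}" using that by auto
  qed (use mix in \<open>simp add: algebra_simps\<close>)
  have sum: "(\<lambda>\<rho>\<in>DM n. f \<rho> + g \<rho>) \<in> ConvFn_set n"
    if "f \<in> ConvFn_set n" "g \<in> ConvFn_set n" "\<forall>\<rho>\<in>DM n. f \<rho> + g \<rho> \<le> 1" for f g
    unfolding ConvFn_set_def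
  proof (intro CollectI conjI ballI)
    show "(\<lambda>\<rho>\<in>DM n. f \<rho> + g \<rho>) \<in> DM n \<rightarrow>\<^sub>E {0..1}" using that rng by (auto intro!: add_nonneg_nonneg)
    show "(\<lambda>\<rho>\<in>DM n. f \<rho> + g \<rho>) (of_real p \<cdot>\<^sub>m \<rho> + of_real (1 - p) \<cdot>\<^sub>m \<sigma>) =
        p * (\<lambda>\<rho>\<in>DM n. f \<rho> + g \<rho>) \<rho> + (1 - p) * (\<lambda>\<rho>\<in>DM n. f \<rho> + g \<rho>) \<sigma>"
      if "\<rho> \<in> DM n" "\<sigma> \<in> DM n" "p \<in> {0..1}" for \<rho> \<sigma> p
      using mix[OF that] cv[OF \<open>f \<in> ConvFn_set n\<close> that] cv[OF \<open>g \<in> ConvFn_set n\<close> that] that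
      by (simp add: distrib_left del: of_real_diff)
  qed
  have compl: "(\<lambda>\<rho>\<in>DM n. 1 - g \<rho>) \<in> ConvFn_set n" if "g \<in> ConvFn_set n" for g
    unfolding ConvFn_set_def
  proof (intro CollectI conjI ballI)
    show "(\<lambda>\<rho>\<in>DM n. 1 - g \<rho>) \<in> DM n \<rightarrow>\<^sub>E {0..1}" using that rng by auto
  qed (use mix cv that in \<open>simp add: algebra_simps\<close>)
  have plus: "eplus ?E f g = Some h \<longleftrightarrow> f \<in> ConvFn_set n \<and> g \<in> ConvFn_set n \<and> h \<in> ConvFn_set n \<and>
      (\<forall>\<rho>\<in>DM n. h \<rho> = f \<rho> + g \<rho>)" for f g h
  proof
    assume "eplus ?E f g = Some h"
    then show "f \<in> ConvFn_set n \<and> g \<in> ConvFn_set n \<and> h \<in> ConvFn_set n \<and> (\<forall>\<rho>\<in>DM n. h \<rho> = f \<rho> + g \<rho>)"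
      using sum[of f g] by (auto simp: ConvFn_def split: if_splits)
  next
    assume a: "f \<in> ConvFn_set n \<and> g \<in> ConvFn_set n \<and> h \<in> ConvFn_set n \<and> (\<forall>\<rho>\<in>DM n. h \<rho> = f \<rho> + g \<rho>)"
    then have le: "\<forall>\<rho>\<in>DM n. f \<rho> + g \<rho> \<le> 1" using rng(2)[of h] by metis
    then have "(\<lambda>\<rho>\<in>DM n. f \<rho> + g \<rho>) = h" using a sum by (intro ext) auto
    then show "eplus ?E f g = Some h" using a le by (simp add: ConvFn_def)
  qed
  have z: "(\<lambda>\<rho>\<in>DM n. 0) \<in> ConvFn_set n" and o: "(\<lambda>\<rho>\<in>DM n. 1) \<in> ConvFn_set n"
    by (auto intro: const)
  show "ezero ?E \<in> carrier ?E" using z by (simp add: ConvFn_def)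
  show "ortho ?E a \<in> carrier ?E" if "a \<in> carrier ?E" for a
    using compl that by (simp add: ConvFn_def)
  show "a \<in> carrier ?E \<and> b \<in> carrier ?E \<and> c \<in> carrier ?E" if "eplus ?E a b = Some c" for a b c
    using that unfolding plus by (auto simp: ConvFn_def)
  show pc: "eplus ?E a b = eplus ?E b a" for a b
    by (auto simp: ConvFn_def add.commute)
  have dir: "Option.bind (eplus ?E b c) (\<lambda>s. eplus ?E a s) = Some t"
    if "Option.bind (eplus ?E a b) (\<lambda>s. eplus ?E s c) = Some t" for a b c t
  proof -
    from that obtain s where m: "a \<in> ConvFn_set n" "b \<in> ConvFn_set n" "c \<in> ConvFn_set n" "t \<in> ConvFn_set n"
      and s: "\<forall>\<rho>\<in>DM n. s \<rho> = a \<rho> + b \<rho>" "\<forall>\<rho>\<in>DM n. t \<rho> = s \<rho> + c \<rho>"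
      by (auto simp: bind_eq_Some_conv plus)
    let ?u = "\<lambda>\<rho>\<in>DM n. b \<rho> + c \<rho>"
    have "b \<rho> + c \<rho> \<le> 1" if "\<rho> \<in> DM n" for \<rho>
      using s that rng(1)[OF m(1) that] rng(2)[OF m(4) that] by simp
    then have "?u \<in> ConvFn_set n" using sum m by blast
    then have "eplus ?E b c = Some ?u" "eplus ?E a ?u = Some t"
      using m s by (auto simp: plus)
    then show ?thesis by simp
  qed
  show "Option.bind (eplus ?E a b) (\<lambda>s. eplus ?E s c) = Option.bind (eplus ?E b c) (\<lambda>s. eplus ?E a s)" for a b c
    using pc dir by (rule kleene_assoc)
  show "eplus ?E (ezero ?E) a = Some a" if "a \<in> carrier ?E" for a
    using that z unfolding plus by (simp add: ConvFn_def)
  show "eplus ?E a (ortho ?E a) = Some (ortho ?E (ezero ?E))" if "a \<in> carrier ?E" for a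
    using that compl[of a] o unfolding one plus by (simp add: ConvFn_def)
  show "b = ortho ?E a" if "eplus ?E a b = Some (ortho ?E (ezero ?E))" for a b
  proof -
    from that have m: "a \<in> ConvFn_set n" "b \<in> ConvFn_set n" "\<forall>\<rho>\<in>DM n. 1 = a \<rho> + b \<rho>"
      unfolding one plus by auto
    have "b = (\<lambda>\<rho>\<in>DM n. 1 - a \<rho>)" using m compl by (intro ext) auto
    then show ?thesis by (simp add: ConvFn_def)
  qed
  show "a = ezero ?E" if "eplus ?E a (ortho ?E (ezero ?E)) = Some c" for a c
  proof -
    from that have m: "a \<in> ConvFn_set n" "c \<in> ConvFn_set n" "\<forall>\<rho>\<in>DM n. c \<rho> = a \<rho> + 1"
      unfolding one plus by auto
    have "a = (\<lambda>\<rho>\<in>DM n. 0)"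
    proof (rule ext[OF m(1) z])
      fix \<rho> assume "\<rho> \<in> DM n"
      then show "a \<rho> = (\<lambda>\<rho>\<in>DM n. 0) \<rho>"
        using m(3) rng(1)[OF m(1), of \<rho>] rng(2)[OF m(2), of \<rho>] by simp
    qed
    then show ?thesis by (simp add: ConvFn_def)
  qed
qed

text \<open>For an effect \<open>L\<close> and a density operator \<open>\<rho>\<close> the complex number \<open>tr (L \<rho>)\<close> is real;
  \<open>Re\<close> only changes its type.\<close>

definition alpha_lpp :: "nat \<Rightarrow> ('x \<Rightarrow> complex mat) \<Rightarrow> 'x \<Rightarrow> complex mat \<Rightarrow> real" where
  "alpha_lpp n \<Delta> = (\<lambda>x. \<lambda>\<rho>\<in>DM n. Re (mtrace (\<Delta> x * \<rho>)))"

end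

(* The map L \<mapsto> (\<rho> \<mapsto> tr (L \<rho>)) is an injective morphism of effect algebras, and injectivity is
   all that is needed: if (Z, e) is a coalgebra for the target effect algebra and m : X \<rightarrow> Z a
   homomorphism from the pushed-forward coalgebra, then e (m a) is the image of the pushforward of
   c a along m.  Hence e lifts uniquely on the images of the two legs of a cospan, and may be
   replaced by zero elsewhere. *)

theory Submission
  imports Defs
begin

section \<open>Finite sums in effect algebras\<close>

context effect_algebra
begin

lemma plus_assocE:
  assumes "eplus E b c = Some u" "eplus E a u = Some t"
  obtains s where "eplus E a b = Some s" "eplus E s c = Some t"
proof -
  have "Option.bind (eplus E a b) (\<lambda>s. eplus E s c) = Some t"
    using assms by (simp add: plus_assoc)
  then show thesis using that by (auto simp: bind_eq_Some_conv)
qed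

lemma esum_closed:
  assumes "finite I" "esum E h I = Some s"
  shows "s \<in> carrier E"
  using assms
  by (induction I arbitrary: s rule: finite_induct)
    (auto simp: esum_empty zero_closed esum_insert bind_eq_Some_conv dest: plus_closed)

text \<open>Only the whole sum is assumed to be defined; Kleene associativity hands definedness down
  to the parts. In the induction, \<open>h i + (a + b)\<close> being defined forces
  \<open>h i + a\<close> to be defined.\<close>

lemma esum_disjoint_UnE:
  assumes "finite I" "finite J" "I \<inter> J = {}" "esum E h (I \<union> J) = Some s"
  obtains a b where "esum E h I = Some a" "esum E h J = Some b" "eplus E a b = Some s"
  using assms
proof (induction I arbitrary: s thesis rule: finite_induct)
  case empty
  then show ?case
    using esum_closed[of J h s] by (simp add: esum_empty plus_zero)
next
  case (insert i I)
  then have "i \<notin> I \<union> J" "finite (I \<union> J)" by auto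
  with insert.prems obtain t where t: "esum E h (I \<union> J) = Some t" "eplus E (h i) t = Some s"
    by (auto simp: esum_insert bind_eq_Some_conv)
  with insert obtain a b where ab: "esum E h I = Some a" "esum E h J = Some b" "eplus E a b = Some t"
    by auto
  from ab(3) t(2) obtain u where "eplus E (h i) a = Some u" "eplus E u b = Some s"
    by (rule plus_assocE)
  with insert ab show ?case by (simp add: esum_insert)
qed

text \<open>Split \<open>I\<close> into \<open>J\<close> and \<open>I - J\<close>: both parts of a
  defined sum are defined.\<close>

lemma esum_subset_defined:
  assumes "finite I" "J \<subseteq> I" "esum E h I \<noteq> None"
  shows "esum E h J \<noteq> None"
proof -
  obtain s where "esum E h (J \<union> (I - J)) = Some s"
    using assms by (auto simp: Un_absorb1)
  then show ?thesis
    using assms by (elim esum_disjoint_UnE[rotated 3]) (auto dest: finite_subset)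
qed

text \<open>Induction on \<open>K\<close>: the fibre over the new index is disjoint from those over
  the old ones, so the disjoint split applies. It also yields that each fibre sum is defined, which
  makes \<open>the\<close> harmless.\<close>

lemma esum_partition:
  assumes "finite K" "finite I" "esum E h {x \<in> I. f x \<in> K} = Some s"
  shows "esum E (\<lambda>y. the (esum E h {x \<in> I. f x = y})) K = Some s"
  using assms(1,3)
proof (induction K arbitrary: s rule: finite_induct)
  case empty
  then show ?case by (simp add: esum_empty)
next
  case (insert y K)
  have "{x \<in> I. f x \<in> insert y K} = {x \<in> I. f x = y} \<union> {x \<in> I. f x \<in> K}" by auto
  with insert.prems have "esum E h ({x \<in> I. f x = y} \<union> {x \<in> I. f x \<in> K}) = Some s" by simp
  then obtain a b where "esum E h {x \<in> I. f x = y} = Some a" "esum E h {x \<in> I. f x \<in> K} = Some b"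
    "eplus E a b = Some s"
    using insert.hyps \<open>finite I\<close> by (elim esum_disjoint_UnE[rotated 3]) auto
  with insert show ?case by (simp add: esum_insert)
qed

section \<open>Distributions and their pushforwards\<close>

lemma Dist_fibre_sum:
  assumes "\<Delta> \<in> Dist E X"
  shows "esum E \<Delta> {x \<in> esupp E X \<Delta>. f x = y} = Some (Dmap E X f \<Delta> y)"
  using assms esum_subset_defined[of "esupp E X \<Delta>" "{x \<in> esupp E X \<Delta>. f x = y}" \<Delta>]
  by (auto simp: Dist_def Dmap_def)

lemma Dist_closed: "\<Delta> \<in> Dist E X \<Longrightarrow> \<Delta> x \<in> carrier E"
  using zero_closed by (cases "x \<in> X") (auto simp: Dist_def)

lemma zero_in_Dist: "(\<lambda>_. ezero E) \<in> Dist E X"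
  by (simp add: Dist_def esupp_def zero_closed esum_empty)

text \<open>The support of the pushforward lies in the image of the old support. Over that image,
  regrouping by fibres returns the original total, which is defined; hence so is the subsum over the
  new support.\<close>

lemma Dmap_in_Dist:
  assumes D: "\<Delta> \<in> Dist E X" and f: "f \<in> X \<rightarrow> Y"
  shows "Dmap E X f \<Delta> \<in> Dist E Y"
proof -
  let ?S = "esupp E X \<Delta>" and ?T = "esupp E Y (Dmap E X f \<Delta>)"
  have fin: "finite ?S" and def: "esum E \<Delta> ?S \<noteq> None" using D by (auto simp: Dist_def)
  have "?T \<subseteq> f ` ?S"
  proof
    fix y assume "y \<in> ?T"
    then have nz: "Dmap E X f \<Delta> y \<noteq> ezero E" by (simp add: esupp_def[of E Y])
    have "{x \<in> ?S. f x = y} \<noteq> {}"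
    proof
      assume "{x \<in> ?S. f x = y} = {}"
      from Dist_fibre_sum[OF D, of f y, unfolded this esum_empty] nz show False by simp
    qed
    then show "y \<in> f ` ?S" by auto
  qed
  moreover have "esum E (Dmap E X f \<Delta>) (f ` ?S) \<noteq> None"
  proof -
    have "{x \<in> ?S. f x \<in> f ` ?S} = ?S" by auto
    then show ?thesis
      using esum_partition[of "f ` ?S" ?S \<Delta> f] fin def by (auto simp: Dmap_def)
  qed
  ultimately have "finite ?T" "esum E (Dmap E X f \<Delta>) ?T \<noteq> None"
    using fin esum_subset_defined[of "f ` ?S" ?T] by (auto intro: finite_subset)
  moreover have "Dmap E X f \<Delta> y \<in> carrier E" for y
    using Dist_fibre_sum[OF D, of f y] fin by (auto intro: esum_closed[rotated])
  moreover have "Dmap E X f \<Delta> y = ezero E" if "y \<notin> Y" for y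
    using that f by (intro Dmap_outside) auto
  ultimately show ?thesis by (auto simp: Dist_def)
qed

end


section \<open>Injective morphisms preserve and reflect kernel bisimilarity\<close>

text \<open>Sums are preserved but not reflected: a sum defined in \<open>F\<close> may be undefined
  in \<open>E\<close>. Whenever a sum in \<open>E\<close> is required, it comes from a distribution
  already given over \<open>E\<close>.\<close>

locale effect_monomorphism = E: effect_algebra E + F: effect_algebra F
  for E :: "('a, 'm) eff_alg_scheme" and F :: "('b, 'n) eff_alg_scheme" +
  fixes \<phi> :: "'a \<Rightarrow> 'b"
  assumes map_zero: "\<phi> (ezero E) = ezero F"
    and map_plus: "eplus E a b = Some s \<Longrightarrow> eplus F (\<phi> a) (\<phi> b) = Some (\<phi> s)"
    and inj: "inj_on \<phi> (carrier E)"
begin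

text \<open>Read off from the preserved sum of \<open>ezero E\<close> and \<open>a\<close>, since
  sums in \<open>F\<close> are defined only on its carrier.\<close>

lemma map_closed: "a \<in> carrier E \<Longrightarrow> \<phi> a \<in> carrier F"
  using map_plus[OF E.plus_zero] F.plus_closed by blast

lemma map_eq_zero_iff: "a \<in> carrier E \<Longrightarrow> \<phi> a = ezero F \<longleftrightarrow> a = ezero E"
  using inj_on_eq_iff[OF inj, of a "ezero E"] E.zero_closed by (simp add: map_zero)

section \<open>Transport of sums, distributions and coalgebras along the morphism\<close>

lemma esum_map:
  assumes "finite I" "esum E h I = Some s"
  shows "esum F (\<phi> \<circ> h) I = Some (\<phi> s)"
  using assms
  by (induction I arbitrary: s rule: finite_induct)
    (auto simp: E.esum_empty F.esum_empty E.esum_insert F.esum_insert map_zero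
      bind_eq_Some_conv map_plus)

text \<open>By injectivity only zero is sent to zero, so sums before and after the map range over
  the same index sets.\<close>

lemma esupp_map: "\<Delta> \<in> Dist E X \<Longrightarrow> esupp F X (\<phi> \<circ> \<Delta>) = esupp E X \<Delta>"
  using E.Dist_closed[of \<Delta> X] by (auto simp: esupp_def map_eq_zero_iff)

lemma Dist_map:
  assumes "\<Delta> \<in> Dist E X"
  shows "\<phi> \<circ> \<Delta> \<in> Dist F X"
  using assms esupp_map[OF assms] esum_map[of "esupp E X \<Delta>" \<Delta>]
  by (auto simp: Dist_def map_closed map_zero)

text \<open>Naturality of the pushforward in the effect algebra: the supports agree, so both sides
  sum the same fibres, and \<open>\<phi>\<close> commutes with defined sums.\<close>

lemma Dmap_map:
  assumes "\<Delta> \<in> Dist E X"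
  shows "Dmap F X f (\<phi> \<circ> \<Delta>) = \<phi> \<circ> Dmap E X f \<Delta>"
proof
  fix y
  have "finite {x \<in> esupp E X \<Delta>. f x = y}" using assms by (simp add: Dist_def)
  then show "Dmap F X f (\<phi> \<circ> \<Delta>) y = (\<phi> \<circ> Dmap E X f \<Delta>) y"
    using esum_map[OF _ E.Dist_fibre_sum[OF assms], of f y]
    by (simp add: Dmap_def[of F] esupp_map[OF assms])
qed

text \<open>Pointwise injectivity suffices even outside \<open>X\<close>, because the value there is
  zero and zero lies in the carrier.\<close>

lemma inj_on_Dist: "inj_on ((\<circ>) \<phi>) (Dist E X)"
proof (rule inj_onI)
  fix \<Delta> \<Delta>' assume D: "\<Delta> \<in> Dist E X" "\<Delta>' \<in> Dist E X" and eq: "\<phi> \<circ> \<Delta> = \<phi> \<circ> \<Delta>'"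
  show "\<Delta> = \<Delta>'"
  proof
    fix x
    show "\<Delta> x = \<Delta>' x"
      using D[THEN E.Dist_closed] fun_cong[OF eq, of x] inj by (auto dest: inj_onD)
  qed
qed

lemma coalgebra_map: "coalgebra E X c \<Longrightarrow> coalgebra F X ((\<circ>) \<phi> \<circ> c)"
  using Dist_map by (fastforce simp: coalgebra_def comp_def)

lemma coalg_hom_map:
  assumes "coalgebra E X c" "coalg_hom E X c Z e m"
  shows "coalg_hom F X ((\<circ>) \<phi> \<circ> c) Z ((\<circ>) \<phi> \<circ> e) m"
  using assms Dmap_map[of "c a" X m for a] by (auto simp: coalg_hom_def coalgebra_def Pi_def)

text \<open>The zero map is a legitimate default because a distribution needs a defined sum, not
  total one. It is used only where \<open>e z\<close> has no preimage.\<close>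

definition lift_coalgebra :: "'z set \<Rightarrow> ('z \<Rightarrow> 'z \<Rightarrow> 'b) \<Rightarrow> 'z \<Rightarrow> 'z \<Rightarrow> 'a" where
  "lift_coalgebra Z e z =
     (if e z \<in> (\<circ>) \<phi> ` Dist E Z then inv_into (Dist E Z) ((\<circ>) \<phi>) (e z) else (\<lambda>_. ezero E))"

lemma coalgebra_lift: "coalgebra E Z (lift_coalgebra Z e)"
  by (simp add: coalgebra_def lift_coalgebra_def E.zero_in_Dist inv_into_into)

lemma coalg_hom_lift:
  assumes c: "coalgebra E X c" and m: "coalg_hom F X ((\<circ>) \<phi> \<circ> c) Z e m"
  shows "coalg_hom E X c Z (lift_coalgebra Z e) m"
  unfolding coalg_hom_def
proof (intro conjI ballI)
  show mZ: "m \<in> X \<rightarrow> Z" using m by (simp add: coalg_hom_def)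
  fix a assume a: "a \<in> X"
  then have ca: "c a \<in> Dist E X" using c by (auto simp: coalgebra_def)
  then have D: "Dmap E X m (c a) \<in> Dist E Z" using mZ by (rule E.Dmap_in_Dist)
  have "e (m a) = \<phi> \<circ> Dmap E X m (c a)"
    using m a by (simp add: coalg_hom_def flip: Dmap_map[OF ca])
  \<comment> \<open>At \<open>m a\<close> the first branch of the lift applies, and by injectivity
    the inverse returns exactly the pushforward of \<open>c a\<close>.\<close>
  then show "Dmap E X m (c a) = lift_coalgebra Z e (m a)"
    using D inv_into_f_f[OF inj_on_Dist D] by (simp add: lift_coalgebra_def)
qed

text \<open>The same apex set and the same legs serve in both directions; only the structure map on
  the apex is mapped forward or lifted.\<close>

theorem kernel_bisimilar_map_iff:
  fixes X :: "'x set" and Y :: "'y set"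
  assumes "coalgebra E X c" "coalgebra E Y d"
  shows "kernel_bisimilar F X ((\<circ>) \<phi> \<circ> c) Y ((\<circ>) \<phi> \<circ> d) x y \<longleftrightarrow> kernel_bisimilar E X c Y d x y"
    (is "?F \<longleftrightarrow> ?E")
proof
  assume ?E
  then obtain Z :: "('x + 'y) set" and e m1 m2 where "coalgebra E Z e"
    "coalg_hom E X c Z e m1" "coalg_hom E Y d Z e m2" "m1 x = m2 y"
    unfolding kernel_bisimilar_def by blast
  with assms show ?F
    unfolding kernel_bisimilar_def by (blast intro: coalgebra_map coalg_hom_map)
next
  assume ?F
  then obtain Z :: "('x + 'y) set" and e m1 m2 where
    "coalg_hom F X ((\<circ>) \<phi> \<circ> c) Z e m1" "coalg_hom F Y ((\<circ>) \<phi> \<circ> d) Z e m2" "m1 x = m2 y"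
    unfolding kernel_bisimilar_def by blast
  with assms show ?E
    unfolding kernel_bisimilar_def by (blast intro: coalgebra_lift coalg_hom_lift)
qed

end


section \<open>The trace pairing of effects and density operators\<close>

definition sesq :: "'i set \<Rightarrow> ('i \<Rightarrow> 'i \<Rightarrow> complex) \<Rightarrow> ('i \<Rightarrow> complex) \<Rightarrow> complex" where
  "sesq S B v = (\<Sum>i\<in>S. \<Sum>j\<in>S. cnj (v i) * B i j * v j)"

text \<open>Block expansion that splits off row and column \<open>k\<close>. Index sets instead of
  matrices allow induction by removing an index. The value \<open>t\<close> stays free: zero
  restricts the form to \<open>S\<close>, another choice completes the square.\<close>

lemma sesq_insert:
  assumes "finite S" "k \<notin> S"
  shows "sesq (insert k S) B (v(k := t)) =
    cnj t * B k k * t + cnj t * (\<Sum>j\<in>S. B k j * v j) + (\<Sum>i\<in>S. cnj (v i) * B i k) * t + sesq S B v"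
proof -
  define w where "w = v(k := t)"
  have "w k = t" "\<And>i. i \<in> S \<Longrightarrow> w i = v i"
    using assms by (auto simp: w_def)
  then show ?thesis
    unfolding w_def[symmetric] using assms
    by (simp add: sesq_def sum.distrib sum_distrib_left sum_distrib_right mult.assoc
        cong: sum.cong_simp)
qed

lemma sesq_mono_neutral:
  assumes "finite S" "T \<subseteq> S" "\<And>i. i \<in> S - T \<Longrightarrow> v i = 0"
  shows "sesq S B v = sesq T B v"
proof -
  have "sesq T B v = (\<Sum>i\<in>T. \<Sum>j\<in>S. cnj (v i) * B i j * v j)"
    unfolding sesq_def using assms by (intro sum.cong sum.mono_neutral_left) auto
  also have "\<dots> = sesq S B v"
    unfolding sesq_def using assms by (intro sum.mono_neutral_left) auto
  finally show ?thesis by simp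
qed

text \<open>Along the vectors with entry 1 at \<open>i\<close> and \<open>- s * B k i\<close> at
  \<open>k\<close>, the form is affine in \<open>s\<close> with slope minus twice the squared
  modulus of \<open>B k i\<close>. Being bounded below for all real \<open>s\<close>, it must have
  slope zero.\<close>

lemma psd_zero_diagonal:
  fixes B :: "'i \<Rightarrow> 'i \<Rightarrow> complex"
  assumes "finite S" "i \<in> S" "k \<in> S"
    and herm: "B i k = cnj (B k i)"
    and pos: "\<And>v. 0 \<le> sesq S B v"
    and "B k k = 0"
  shows "B k i = 0"
proof (cases "i = k")
  case False
  have le: "2 * s * (cmod (B k i))\<^sup>2 \<le> Re (B i i)" for s :: real
  proof -
    let ?v = "\<lambda>j. if j = i then 1 else if j = k then - of_real s * B k i else 0"
    have "sesq S B ?v = sesq {i, k} B ?v"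
      using assms(1-3) by (intro sesq_mono_neutral) auto
    also have "\<dots> = B i i - 2 * of_real s * (B k i * cnj (B k i))"
      using False \<open>B k k = 0\<close> herm by (simp add: sesq_def)
    also have "\<dots> = B i i - of_real (2 * s * (cmod (B k i))\<^sup>2)"
      by (simp only: of_real_mult of_real_numeral complex_norm_square)
    finally show ?thesis
      using pos[of ?v] by (simp only: less_eq_complex_def minus_complex.sel Re_complex_of_real) simp
  qed
  show ?thesis
  proof (rule ccontr)
    assume "B k i \<noteq> 0"
    \<comment> \<open>This \<open>s\<close> turns the left side of \<open>le\<close> into
      \<open>Re (B i i) + 1\<close>.\<close>
    then show False using le[of "(Re (B i i) + 1) / (2 * (cmod (B k i))\<^sup>2)"] by simp
  qed
qed (use assms in simp)

text \<open>Induction on the index set: splitting off the index \<open>k\<close> writes \<open>B\<close> as the rank one form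
  \<open>b b\<^sup>* / B\<^sub>k\<^sub>k\<close> given by the column \<open>b\<close> at \<open>k\<close> plus the Schur complement, which is again positive.
  If \<open>B\<^sub>k\<^sub>k = 0\<close>, then \<open>b = 0\<close>, so the junk value of the quotient is the right one.\<close>

lemma psd_pairing_nonneg:
  fixes A B :: "'i \<Rightarrow> 'i \<Rightarrow> complex"
  assumes "finite S"
    and "\<And>v. 0 \<le> sesq S A v"
    and "\<And>v. 0 \<le> sesq S B v"
    and "\<And>i j. i \<in> S \<Longrightarrow> j \<in> S \<Longrightarrow> B i j = cnj (B j i)"
  shows "0 \<le> (\<Sum>i\<in>S. \<Sum>j\<in>S. A i j * B j i)"
  using assms
proof (induction S arbitrary: B rule: finite_induct)
  case empty
  then show ?case by simp
next
  case (insert k S)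
  let ?K = "insert k S"
  define \<beta> where "\<beta> = B k k"
  define C where "C i j = B i j - B i k * B k j / \<beta>" for i j
  have herm: "B i j = cnj (B j i)" if "i \<in> ?K" "j \<in> ?K" for i j
    using insert.prems that by blast
  have \<beta>_real: "cnj \<beta> = \<beta>" using herm[of k k] by (simp add: \<beta>_def)
  have restrict: "sesq S M v = sesq ?K M (v(k := 0))" for M v
    using insert.hyps by (simp add: sesq_insert)
  have \<beta>_nonneg: "0 \<le> \<beta>"
  proof -
    let ?v = "\<lambda>i. if i = k then 1 else 0"
    have "sesq ?K B ?v = sesq {k} B ?v"
      by (rule sesq_mono_neutral) (use insert.hyps in auto)
    then show ?thesis using insert.prems(2)[of ?v] by (simp add: sesq_def[of "{k}"] \<beta>_def)
  qed
  have cancel: "\<beta> * (B k i / \<beta>) = B k i" if "i \<in> ?K" for i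
    using psd_zero_diagonal[OF _ that _ herm insert.prems(2)] that insert.hyps
    by (cases "\<beta> = 0") (simp_all add: \<beta>_def)
  have C_pos: "0 \<le> sesq S C v" for v
  proof -
    define s where "s = (\<Sum>j\<in>S. B k j * v j)"
    \<comment> \<open>Chosen to complete the square: with \<open>- t\<close> as coordinate
      \<open>k\<close>, the form of \<open>B\<close> takes the value of the form of \<open>C\<close>
      at \<open>v\<close>.\<close>
    define t where "t = s / \<beta>"
    have s: "s = \<beta> * t"
    proof -
      have "\<beta> * t = (\<Sum>j\<in>S. \<beta> * (B k j / \<beta>) * v j)"
        by (simp only: t_def s_def sum_divide_distrib sum_distrib_left
            times_divide_eq_right times_divide_eq_left mult.assoc)
      also have "\<dots> = s" unfolding s_def using cancel by (intro sum.cong) auto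
      finally show ?thesis by simp
    qed
    have cnj_s: "(\<Sum>i\<in>S. cnj (v i) * B i k) = cnj s"
      unfolding s_def cnj_sum using herm[of _ k] by (intro sum.cong) auto
    have "sesq ?K B (v(k := - t)) =
        cnj t * \<beta> * t - cnj t * (\<Sum>j\<in>S. B k j * v j) - (\<Sum>i\<in>S. cnj (v i) * B i k) * t + sesq S B v"
      using insert.hyps by (simp add: sesq_insert \<beta>_def)
    also have "\<dots> = sesq S B v - cnj s * t"
      unfolding cnj_s s_def[symmetric] by (simp add: s \<beta>_real)
    finally have B_form: "sesq ?K B (v(k := - t)) = sesq S B v - cnj s * t" .
    have "cnj s * t = (\<Sum>i\<in>S. \<Sum>j\<in>S. (cnj (v i) * B i k) * (B k j * v j)) / \<beta>"
      unfolding t_def s_def[symmetric] cnj_s[symmetric] by (simp add: s_def sum_product)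
    then have "sesq S C v = sesq S B v - cnj s * t"
      by (simp add: sesq_def C_def sum_divide_distrib left_diff_distrib right_diff_distrib
          sum_subtractf mult.assoc)
    then show ?thesis using B_form insert.prems(2)[of "v(k := - t)"] by (simp only:)
  qed
  have C_herm: "C i j = cnj (C j i)" if "i \<in> S" "j \<in> S" for i j
    using that herm[of i j] herm[of i k] herm[of k j] by (simp add: C_def \<beta>_real mult.commute)
  have "0 \<le> (\<Sum>i\<in>S. \<Sum>j\<in>S. A i j * C j i)"
  proof (rule insert.IH)
    show "0 \<le> sesq S A v" for v unfolding restrict by (rule insert.prems(1))
  qed (fact C_pos C_herm)+
  \<comment> \<open>Subtracting the rank one part clears row and column \<open>k\<close> of
    \<open>C\<close>, so index \<open>k\<close> contributes nothing.\<close>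
  also have "\<dots> = (\<Sum>i\<in>?K. \<Sum>j\<in>?K. A i j * C j i)"
  proof -
    have "C i k = 0" "C k i = 0" if "i \<in> ?K" for i
      using cancel[OF that] herm[OF that, of k]
      by (cases "\<beta> = 0"; simp add: C_def \<beta>_def[symmetric])+
    then show ?thesis using insert.hyps by simp
  qed
  finally have "0 \<le> (\<Sum>i\<in>?K. \<Sum>j\<in>?K. A i j * C j i)" .
  \<comment> \<open>This is the pairing of \<open>A\<close> with the rank one part: the form of
    \<open>A\<close> at column \<open>k\<close> of \<open>B\<close>, scaled by
    \<open>1 / \<beta>\<close>.\<close>
  moreover have "0 \<le> sesq ?K A (\<lambda>i. B i k) / \<beta>"
  proof -
    obtain b where "\<beta> = of_real b" "0 \<le> b"
      using \<beta>_nonneg by (intro that[of "Re \<beta>"]) (auto simp: less_eq_complex_def complex_eq_iff)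
    then show ?thesis
      using insert.prems(1)[of "\<lambda>i. B i k"] by (simp add: less_eq_complex_def)
  qed
  moreover have "(\<Sum>i\<in>?K. \<Sum>j\<in>?K. A i j * B j i) =
      (\<Sum>i\<in>?K. \<Sum>j\<in>?K. A i j * C j i) + sesq ?K A (\<lambda>i. B i k) / \<beta>"
  proof -
    have "A i j * B j i = A i j * C j i + cnj (B i k) * A i j * B j k / \<beta>"
      if "i \<in> ?K" for i j
      using herm[of k i] that by (simp add: C_def right_diff_distrib mult_ac)
    then show ?thesis
      unfolding sesq_def sum_divide_distrib sum.distrib[symmetric] by (intro sum.cong refl)
  qed
  ultimately show ?case by simp
qed

section \<open>Matrices as forms over the indices below \<open>n\<close>\<close>

lemma psd_index_cnj:
  assumes "psd n A" "i < n" "j < n"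
  shows "cnj (A $$ (j, i)) = A $$ (i, j)"
  using assms adjoint_index[of A n i j] by (simp add: psd_def)

lemma mat_adjoint_eqI:
  assumes "A \<in> carrier_mat n n" "\<And>i j. i < n \<Longrightarrow> j < n \<Longrightarrow> cnj (A $$ (j, i)) = A $$ (i, j)"
  shows "mat_adjoint A = A"
proof (rule eq_matI)
  show "dim_row (mat_adjoint A) = dim_row A" "dim_col (mat_adjoint A) = dim_col A"
    using assms(1) by (auto simp: mat_adjoint_def)
qed (use assms in \<open>simp add: adjoint_index[of _ n]\<close>)

lemma quadratic_form_eq_sesq:
  assumes "A \<in> carrier_mat n n" "v \<in> carrier_vec n"
  shows "(A *\<^sub>v v) \<bullet>c v = sesq {..<n} (\<lambda>i j. A $$ (i, j)) (\<lambda>i. v $ i)"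
  using assms
  by (simp add: sesq_def scalar_prod_def sum_distrib_left sum_distrib_right mult_ac
      atLeast0LessThan cong: sum.cong_simp)

lemma psd_sesq_nonneg:
  assumes "psd n A"
  shows "0 \<le> sesq {..<n} (\<lambda>i j. A $$ (i, j)) v"
proof -
  have "sesq {..<n} (\<lambda>i j. A $$ (i, j)) v = sesq {..<n} (\<lambda>i j. A $$ (i, j)) (\<lambda>i. vec n v $ i)"
    by (simp add: sesq_def)
  also have "\<dots> = (A *\<^sub>v vec n v) \<bullet>c vec n v"
    using assms by (simp add: quadratic_form_eq_sesq[of _ n] psd_carrier)
  also have "0 \<le> \<dots>" using assms by (simp add: psd_def)
  finally show ?thesis .
qed

lemma mtrace_mult:
  assumes "A \<in> carrier_mat n n" "B \<in> carrier_mat n n"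
  shows "mtrace (A * B) = (\<Sum>i<n. \<Sum>j<n. A $$ (i, j) * B $$ (j, i))"
  using assms by (simp add: mtrace_def scalar_prod_def atLeast0LessThan cong: sum.cong_simp)

text \<open>The trace of the product is the entrywise pairing of \<open>psd_pairing_nonneg\<close>.
  The complex order also makes this trace real, so taking \<open>Re\<close> loses nothing.\<close>

lemma mtrace_mult_psd_nonneg:
  assumes "psd n A" "psd n B"
  shows "0 \<le> mtrace (A * B)"
  using psd_pairing_nonneg[of "{..<n}" "\<lambda>i j. A $$ (i, j)" "\<lambda>i j. B $$ (i, j)"] assms
  by (simp add: mtrace_mult[of _ n] psd_carrier psd_sesq_nonneg psd_index_cnj)

lemma mtrace_add_mult:
  assumes "A \<in> carrier_mat n n" "B \<in> carrier_mat n n" "M \<in> carrier_mat n n"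
  shows "mtrace ((A + B) * M) = mtrace (A * M) + mtrace (B * M)"
  using assms by (simp add: mtrace_mult[of _ n] sum.distrib distrib_right)

section \<open>Density operators separate effects\<close>

lemma rank_one_psd:
  assumes "v \<in> carrier_vec n"
  shows "psd n (mat n n (\<lambda>(i, j). v $ i * cnj (v $ j)))" (is "psd n ?P")
proof -
  have "mat_adjoint ?P = ?P"
    by (rule mat_adjoint_eqI[of _ n]) auto
  moreover have "0 \<le> (?P *\<^sub>v u) \<bullet>c u" if u: "u \<in> carrier_vec n" for u
  proof -
    have "(?P *\<^sub>v u) \<bullet>c u = (\<Sum>i<n. v $ i * cnj (u $ i)) * (\<Sum>j<n. cnj (v $ j) * u $ j)"
      unfolding sum_product using u by (simp add: quadratic_form_eq_sesq[of _ n] sesq_def mult_ac)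
    also have "\<dots> = (\<Sum>i<n. v $ i * cnj (u $ i)) * cnj (\<Sum>i<n. v $ i * cnj (u $ i))"
      by simp
    finally show ?thesis by (simp only: conjugate_complex_def[symmetric] conjugate_square_positive)
  qed
  ultimately show ?thesis by (simp add: psd_def)
qed

text \<open>Expresses every value of the quadratic form of \<open>A\<close> as a trace against a
  positive matrix, which becomes a density operator after scaling when \<open>v\<close> is
  nonzero.\<close>

lemma mtrace_mult_rank_one:
  assumes "A \<in> carrier_mat n n" "v \<in> carrier_vec n"
  shows "mtrace (A * mat n n (\<lambda>(i, j). v $ i * cnj (v $ j))) = (A *\<^sub>v v) \<bullet>c v"
  using assms
  by (simp add: mtrace_mult[of _ n] quadratic_form_eq_sesq[of _ n] sesq_def mult_ac)

text \<open>Testing on normalised rank one operators shows that \<open>A\<close> and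
  \<open>B\<close> have the same quadratic form. Then \<open>A - B\<close> and \<open>B - A\<close>
  are Hermitian with zero form, so both are positive, and antisymmetry gives equality.\<close>

lemma effect_eq_if_density_traces_eq:
  assumes A: "psd n A" and B: "psd n B"
    and tr: "\<And>\<rho>. \<rho> \<in> DM n \<Longrightarrow> Re (mtrace (A * \<rho>)) = Re (mtrace (B * \<rho>))"
  shows "A = B"
proof -
  have car: "A \<in> carrier_mat n n" "B \<in> carrier_mat n n" using A B by (auto simp: psd_carrier)
  have form: "(A *\<^sub>v v) \<bullet>c v = (B *\<^sub>v v) \<bullet>c v" if v: "v \<in> carrier_vec n" for v
  proof (cases "v = 0\<^sub>v n")
    \<comment> \<open>The zero vector cannot be normalised. This case also covers
      \<open>n = 0\<close>, where there are no density operators.\<close>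
    case True
    then show ?thesis using car by simp
  next
    case False
    define P where "P = mat n n (\<lambda>(i, j). v $ i * cnj (v $ j))"
    define r where "r = Re (v \<bullet>c v)"
    have P: "P \<in> carrier_mat n n" by (simp add: P_def)
    have pos: "0 < v \<bullet>c v" using v False by simp
    then have r: "0 < r" "v \<bullet>c v = of_real r"
      by (auto simp: r_def less_complex_def complex_eq_iff)
    have scale: "mtrace (M * (of_real (1 / r) \<cdot>\<^sub>m P)) = of_real (1 / r) * ((M *\<^sub>v v) \<bullet>c v)"
      if "M \<in> carrier_mat n n" for M
      unfolding mtrace_mult_rank_one[OF that v, folded P_def, symmetric] using that P
      by (simp add: mult_smult_distrib[of _ n n] mtrace_def sum_distrib_left)
    have "of_real (1 / r) \<cdot>\<^sub>m P \<in> DM n"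
    proof -
      have "mtrace (1\<^sub>m n * (of_real (1 / r) \<cdot>\<^sub>m P)) = 1"
        using scale[of "1\<^sub>m n"] v r by simp
      moreover have "1\<^sub>m n * (of_real (1 / r) \<cdot>\<^sub>m P) = of_real (1 / r) \<cdot>\<^sub>m P"
        using P by (intro left_mult_one_mat[of _ n n]) simp
      moreover have "psd n (of_real (1 / r) \<cdot>\<^sub>m P)"
        using rank_one_psd[OF v] r by (intro psd_scale) (auto simp: P_def)
      ultimately show ?thesis by (simp add: DM_def)
    qed
    from tr[OF this] have "Re ((A *\<^sub>v v) \<bullet>c v) = Re ((B *\<^sub>v v) \<bullet>c v)"
      unfolding scale[OF car(1)] scale[OF car(2)] using r by simp
    \<comment> \<open>The traces compare real parts only; positivity makes both imaginary parts
      vanish.\<close>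
    moreover have "0 \<le> (A *\<^sub>v v) \<bullet>c v" "0 \<le> (B *\<^sub>v v) \<bullet>c v"
      using A B v by (auto simp: psd_def)
    ultimately show ?thesis by (simp add: less_eq_complex_def complex_eq_iff)
  qed
  have diff: "psd n (M - N)"
    if "psd n M" "psd n N" and eq: "\<And>v. v \<in> carrier_vec n \<Longrightarrow> (M *\<^sub>v v) \<bullet>c v = (N *\<^sub>v v) \<bullet>c v" for M N
  proof -
    have car: "M \<in> carrier_mat n n" "N \<in> carrier_mat n n" using that by (auto simp: psd_carrier)
    have "mat_adjoint (M - N) = M - N"
      using car psd_index_cnj[OF that(1)] psd_index_cnj[OF that(2)]
      by (intro mat_adjoint_eqI[of _ n]) auto
    moreover have "((M - N) *\<^sub>v v) \<bullet>c v = 0" if "v \<in> carrier_vec n" for v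
      using car that eq
      by (simp add: minus_mult_distrib_mat_vec[of _ n n] minus_scalar_prod_distrib[of _ n])
    ultimately show ?thesis using minus_carrier_mat[OF car(2)] by (simp add: psd_def)
  qed
  have "- (A - B) = B - A" using car by (intro eq_matI) auto
  then have "A - B = 0\<^sub>m n n"
    using diff[OF A B form] diff[OF B A form[symmetric]] by (intro psd_antisym) auto
  then have "(A - B) $$ (i, j) = 0" if "i < n" "j < n" for i j using that by simp
  then show ?thesis using car by (intro eq_matI) auto
qed

section \<open>The trace pairing as a monomorphism of effect algebras\<close>

definition trace_functional :: "nat \<Rightarrow> complex mat \<Rightarrow> complex mat \<Rightarrow> real" where
  "trace_functional n L = (\<lambda>\<rho>\<in>DM n. Re (mtrace (L * \<rho>)))"

text \<open>Exhibits the transformation as postcomposition with a single map of effect algebras, the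
  form required by \<open>kernel_bisimilar_map_iff\<close>.\<close>

lemma alpha_lpp_eq_comp: "alpha_lpp n = (\<circ>) (trace_functional n)"
  by (intro ext) (simp add: alpha_lpp_def trace_functional_def)

text \<open>The bounds come from \<open>L\<close> and its complement together: their traces against
  \<open>\<rho>\<close> are nonnegative and add up to the trace of \<open>\<rho>\<close>, which is
  1. Affinity is linearity of the trace.\<close>

lemma trace_functional_convex:
  assumes L: "L \<in> Ef_set n"
  shows "trace_functional n L \<in> ConvFn_set n"
proof -
  have psd: "psd n L" "psd n (1\<^sub>m n - L)" using L by (auto simp: Ef_set_iff)
  have car: "L \<in> carrier_mat n n" using psd psd_carrier by blast
  have "trace_functional n L \<rho> \<in> {0..1}" if "\<rho> \<in> DM n" for \<rho>
  proof -
    have \<rho>: "psd n \<rho>" "mtrace \<rho> = 1" "\<rho> \<in> carrier_mat n n"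
      using that by (auto simp: DM_def psd_carrier)
    have "L + (1\<^sub>m n - L) = 1\<^sub>m n" using car by (intro eq_matI) auto
    then have "mtrace (L * \<rho>) + mtrace ((1\<^sub>m n - L) * \<rho>) = 1"
      using mtrace_add_mult[of L n "1\<^sub>m n - L" \<rho>] car \<rho> minus_carrier_mat[OF car]
      by simp
    then have "Re (mtrace (L * \<rho>)) + Re (mtrace ((1\<^sub>m n - L) * \<rho>)) = 1"
      by (metis plus_complex.sel(1) one_complex.sel(1))
    then show ?thesis
      using that mtrace_mult_psd_nonneg[OF psd(1) \<rho>(1)] mtrace_mult_psd_nonneg[OF psd(2) \<rho>(1)]
      by (simp add: trace_functional_def less_eq_complex_def)
  qed
  moreover have "trace_functional n L (of_real p \<cdot>\<^sub>m \<rho> + of_real (1 - p) \<cdot>\<^sub>m \<sigma>) =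
      p * trace_functional n L \<rho> + (1 - p) * trace_functional n L \<sigma>"
    if "\<rho> \<in> DM n" "\<sigma> \<in> DM n" "p \<in> {0..1}" for \<rho> \<sigma> p
  proof -
    have c: "\<rho> \<in> carrier_mat n n" "\<sigma> \<in> carrier_mat n n"
      using that by (auto simp: DM_def psd_carrier)
    have "L * (of_real p \<cdot>\<^sub>m \<rho> + of_real (1 - p) \<cdot>\<^sub>m \<sigma>) =
        of_real p \<cdot>\<^sub>m (L * \<rho>) + of_real (1 - p) \<cdot>\<^sub>m (L * \<sigma>)"
      using c car
      by (simp add: mult_add_distrib_mat[of _ n n _ n] mult_smult_distrib[of _ n n _ n]
          del: of_real_diff)
    then have "mtrace (L * (of_real p \<cdot>\<^sub>m \<rho> + of_real (1 - p) \<cdot>\<^sub>m \<sigma>)) =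
        of_real p * mtrace (L * \<rho>) + of_real (1 - p) * mtrace (L * \<sigma>)"
      using c car by (simp add: mtrace_def sum.distrib sum_distrib_left del: of_real_diff)
    then show ?thesis
      using that DM_convex[OF that] by (simp add: trace_functional_def del: of_real_diff)
  qed
  moreover have "trace_functional n L \<in> extensional (DM n)" by (simp add: trace_functional_def)
  ultimately show ?thesis by (auto simp: ConvFn_set_def PiE_def)
qed

lemma effect_monomorphism_trace_functional:
  "effect_monomorphism (Ef n) (ConvFn n) (trace_functional n)"
proof -
  interpret Ef: effect_algebra "Ef n" by (rule effect_algebra_Ef)
  interpret ConvFn: effect_algebra "ConvFn n" by (rule effect_algebra_ConvFn)
  show ?thesis
  proof
    have "mtrace (0\<^sub>m n n * \<rho>) = 0" if "\<rho> \<in> DM n" for \<rho>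
      using that by (auto simp: DM_def mtrace_def dest: psd_carrier)
    then show "trace_functional n (ezero (Ef n)) = ezero (ConvFn n)"
      by (auto simp: trace_functional_def Ef_def ConvFn_def)
  next
    fix A B s assume plus: "eplus (Ef n) A B = Some s"
    then have m: "A \<in> Ef_set n" "B \<in> Ef_set n" "s \<in> Ef_set n" and s: "s = A + B"
      using Ef.plus_closed[OF plus] by (auto simp: Ef_def split: if_splits)
    have sum: "trace_functional n s \<rho> = trace_functional n A \<rho> + trace_functional n B \<rho>"
      if "\<rho> \<in> DM n" for \<rho>
      using that m unfolding s
      by (simp add: trace_functional_def mtrace_add_mult[of _ n] Ef_set_iff psd_carrier DM_def)
    \<comment> \<open>The sum is defined among convex functions because it is the functional of the
      effect \<open>s\<close>, whose values are at most 1.\<close>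
    have "trace_functional n A \<rho> + trace_functional n B \<rho> \<le> 1" if "\<rho> \<in> DM n" for \<rho>
      using trace_functional_convex[OF m(3)] that
      unfolding sum[OF that, symmetric] by (auto simp: ConvFn_set_def)
    moreover have "(\<lambda>\<rho>\<in>DM n. trace_functional n A \<rho> + trace_functional n B \<rho>) = trace_functional n s"
      using sum by (auto simp: trace_functional_def)
    ultimately show "eplus (ConvFn n) (trace_functional n A) (trace_functional n B) =
        Some (trace_functional n s)"
      using m by (simp add: ConvFn_def trace_functional_convex)
  next
    show "inj_on (trace_functional n) (carrier (Ef n))"
    proof (rule inj_onI)
      fix A B assume m: "A \<in> carrier (Ef n)" "B \<in> carrier (Ef n)"
        and eq: "trace_functional n A = trace_functional n B"
      show "A = B"
      proof (rule effect_eq_if_density_traces_eq)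
        show "psd n A" "psd n B" using m by (auto simp: Ef_def Ef_set_iff)
        show "Re (mtrace (A * \<rho>)) = Re (mtrace (B * \<rho>))" if "\<rho> \<in> DM n" for \<rho>
          using fun_cong[OF eq, of \<rho>] that by (simp add: trace_functional_def)
      qed
    qed
  qed
qed

theorem mainTheorem6:
  fixes n :: nat
    and X :: "'x set" and c :: "'x \<Rightarrow> 'x \<Rightarrow> complex mat"
    and Y :: "'y set" and d :: "'y \<Rightarrow> 'y \<Rightarrow> complex mat"
  assumes "coalgebra (Ef n) X c"
    and "coalgebra (Ef n) Y d"
    and "x \<in> X" and "y \<in> Y"
  shows "kernel_bisimilar (Ef n) X c Y d x y \<longleftrightarrow>
         kernel_bisimilar (ConvFn n) X (alpha_lpp n \<circ> c) Y (alpha_lpp n \<circ> d) x y"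
proof -
  interpret effect_monomorphism "Ef n" "ConvFn n" "trace_functional n"
    by (rule effect_monomorphism_trace_functional)
  show ?thesis
    unfolding alpha_lpp_eq_comp using kernel_bisimilar_map_iff[OF assms(1,2)] by simp
qed

end
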